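(* For every integer $b\ge1$, $$\lambda(Q_{2,b})=\frac12 .$$
   Context: An ordered graph is a finite graph with a fixed linear order on its vertices. A weighted forward-edge template is a triple $\mathcal T=(Q,\mu,A)$, where $Q$ is a finite label set, $\mu$ is a probability measure on $Q$, and $A\subseteq Q\times Q$. The template supports an ordered graph $F$ if there is a map (not necessarily injective) $\phi:V(F)\to Q$ such that $(\phi(i),\phi(j))\in A$ for every edge $ij$ of $F$ with $i<j$; otherwise it is $F$-avoiding. Put $w(\mathcal T)=\sum_{(q,q')\in A}\mu(q)\mu(q')$ and $\lambda(F)=\sup\{w(\mathcal T):\mathcal T\text{ is }F\text{-avoiding}\}$. For $b\ge1$, $Q_{2,b}$ is the ordered graph on vertices $1<2<\cdots<b+3$ with edges $12,\ 13,\ 23,\ 34,\ 45,\ \ldots,\ (b+2)(b+3)$. *)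

theory Defs
  imports "HOL-Probability.Probability_Mass_Function"
begin

text \<open>The linear order on the vertices is the one of the vertex type; an edge \<open>ij\<close> is
  the two-element set \<open>{i, j}\<close>.\<close>

record 'v ordered_graph =
  verts :: "'v set"
  edges :: "'v set set"

definition is_ordered_graph :: "'v::linorder ordered_graph \<Rightarrow> bool" where
  "is_ordered_graph F \<longleftrightarrow>
     finite (verts F) \<and> edges F \<subseteq> {{i, j} | i j. i \<in> verts F \<and> j \<in> verts F \<and> i < j}"

text \<open>The measure may vanish on some labels; such labels can still be used by supporting maps.\<close>

record 'q template =
  labels :: "'q set"
  mass :: "'q pmf"
  arcs :: "('q \<times> 'q) set"

definition is_template :: "'q template \<Rightarrow> bool" where
  "is_template T \<longleftrightarrow>
     finite (labels T) \<and> set_pmf (mass T) \<subseteq> labels T \<and> arcs T \<subseteq> labels T \<times> labels T"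

definition supports :: "'q template \<Rightarrow> 'v::linorder ordered_graph \<Rightarrow> bool" where
  "supports T F \<longleftrightarrow>
     (\<exists>\<phi>. \<phi> \<in> verts F \<rightarrow> labels T \<and>
          (\<forall>i j. {i, j} \<in> edges F \<and> i < j \<longrightarrow> (\<phi> i, \<phi> j) \<in> arcs T))"

abbreviation avoids :: "'q template \<Rightarrow> 'v::linorder ordered_graph \<Rightarrow> bool" where
  "avoids T F \<equiv> \<not> supports T F"

definition weight :: "'q template \<Rightarrow> real" where
  "weight T = (\<Sum>(q, q')\<in>arcs T. pmf (mass T) q * pmf (mass T) q')"

text \<open>The supremum ranges over templates with labels in \<open>nat\<close>. As label sets are finite, this
  covers templates over every label type up to renaming: see \<open>template_relabel\<close> below.
  The weights are bounded by \<open>1\<close> (\<open>weight_le_1\<close>), so the real supremum is the intended one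
  as soon as some template avoids \<open>F\<close>.\<close>

definition lambda :: "'v::linorder ordered_graph \<Rightarrow> real" where
  "lambda F = Sup {weight T | T :: nat template. is_template T \<and> avoids T F}"

definition Q2 :: "nat \<Rightarrow> nat ordered_graph" where
  "Q2 b = \<lparr>verts = {1..b + 3},
           edges = {{1, 2}, {1, 3}, {2, 3}} \<union> {{i, i + 1} | i. 3 \<le> i \<and> i \<le> b + 2}\<rparr>"

lemma is_ordered_graph_Q2: "is_ordered_graph (Q2 b)"
proof -
  have "\<exists>i j. e = {i, j} \<and> i \<in> {1..b + 3} \<and> j \<in> {1..b + 3} \<and> i < j"
    if e: "e \<in> edges (Q2 b)" for e
  proof -
    consider "e = {1, 2}" | "e = {1, 3}" | "e = {2, 3}"
      | i where "e = {i, i + 1}" "3 \<le> i" "i \<le> b + 2"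
      using e unfolding Q2_def by auto
    then show ?thesis
    proof cases
      case 1 then show ?thesis by (intro exI[of _ 1] exI[of _ 2]) auto
    next
      case 2 then show ?thesis by (intro exI[of _ 1] exI[of _ 3]) auto
    next
      case 3 then show ?thesis by (intro exI[of _ 2] exI[of _ 3]) auto
    next
      case 4 then show ?thesis by (intro exI[of _ i] exI[of _ "i + 1"]) auto
    qed
  qed
  then show ?thesis
    by (auto simp: is_ordered_graph_def Q2_def)
qed

lemma weight_le_1:
  assumes "is_template T"
  shows "weight T \<le> 1"
proof -
  let ?L = "labels T" and ?p = "pmf (mass T)"
  have fin: "finite ?L" and sub: "set_pmf (mass T) \<subseteq> ?L" and A: "arcs T \<subseteq> ?L \<times> ?L"
    using assms by (auto simp: is_template_def)
  have "weight T \<le> (\<Sum>(q, q')\<in>?L \<times> ?L. ?p q * ?p q')"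
    unfolding weight_def using fin A by (intro sum_mono2) auto
  also have "\<dots> = (\<Sum>q\<in>?L. ?p q) * (\<Sum>q\<in>?L. ?p q)"
    by (simp add: sum_product sum.cartesian_product)
  also have "\<dots> = 1"
    using sum_pmf_eq_1[OF fin sub] by simp
  finally show ?thesis .
qed

lemma template_relabel:
  fixes T :: "'q template" and F :: "'v::linorder ordered_graph"
  assumes T: "is_template T" "avoids T F"
  shows "\<exists>T' :: nat template. is_template T' \<and> avoids T' F \<and> weight T' = weight T"
proof -
  let ?L = "labels T" and ?p = "mass T"
  have fin: "finite ?L" and sub: "set_pmf ?p \<subseteq> ?L" and A: "arcs T \<subseteq> ?L \<times> ?L"
    using T by (auto simp: is_template_def)
  obtain f :: "'q \<Rightarrow> nat" where f: "inj_on f ?L"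
    using finite_imp_inj_to_nat_seg[OF fin] by blast
  define T' where
    "T' = \<lparr>labels = f ` ?L, mass = map_pmf f ?p, arcs = map_prod f f ` arcs T\<rparr>"
  have pmf_f: "pmf (map_pmf f ?p) (f q) = pmf ?p q" if "q \<in> ?L" for q
  proof (cases "q \<in> set_pmf ?p")
    case True
    then show ?thesis using f sub by (intro pmf_map_inj) (auto intro: inj_on_subset)
  next
    case False
    then have "f q \<notin> f ` set_pmf ?p"
      using f sub that by (auto dest: inj_onD)
    then show ?thesis using False by (simp add: set_pmf_iff flip: set_map_pmf)
  qed
  have injA: "inj_on (map_prod f f) (arcs T)"
    using inj_on_subset[OF map_prod_inj_on[OF f f] A] .
  have "is_template T'"
    using fin sub A by (auto simp: T'_def is_template_def)
  moreover have "avoids T' F"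
  proof
    assume "supports T' F"
    then obtain \<phi> where \<phi>: "\<phi> \<in> verts F \<rightarrow> f ` ?L"
      and e: "\<And>i j. {i, j} \<in> edges F \<Longrightarrow> i < j \<Longrightarrow> (\<phi> i, \<phi> j) \<in> map_prod f f ` arcs T"
      by (auto simp: supports_def T'_def)
    let ?\<psi> = "\<lambda>v. inv_into ?L f (\<phi> v)"
    have "?\<psi> \<in> verts F \<rightarrow> ?L"
      using \<phi> by (auto simp: Pi_iff intro!: inv_into_into)
    moreover have "(?\<psi> i, ?\<psi> j) \<in> arcs T" if ij: "{i, j} \<in> edges F" "i < j" for i j
    proof -
      obtain a b where "(a, b) \<in> arcs T" "\<phi> i = f a" "\<phi> j = f b"
        using e[OF ij] by auto
      then show ?thesis using A f by (auto simp: inv_into_f_f)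
    qed
    ultimately show False using T(2) by (auto simp: supports_def)
  qed
  moreover have "weight T' = weight T"
  proof -
    have "weight T' = (\<Sum>x\<in>arcs T. pmf (map_pmf f ?p) (f (fst x)) * pmf (map_pmf f ?p) (f (snd x)))"
      by (simp add: weight_def T'_def sum.reindex[OF injA] case_prod_beta)
    also have "\<dots> = weight T"
      unfolding weight_def using A by (intro sum.cong) (auto simp: pmf_f)
    finally show ?thesis .
  qed
  ultimately show ?thesis by blast
qed

end

theory Submission
  imports Defs
begin

text \<open>
  The extremal template is a single digon: two labels of mass \<open>1/2\<close> joined by arcs in both
  directions. It has weight \<open>1/2\<close> and, having only two labels and no loop, it has no room for the
  triangle on \<open>1, 2, 3\<close>.

  For the upper bound, if every pair of labels had an arc in at most one direction and there were
  no loops, the weight would be at most half the square of the total mass; only digons \<open>x \<leftrightarrow> y\<close>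
  can violate this, counting a loop as a digon with \<open>x = y\<close>. From a vertex of a digon a walk can
  oscillate forever, so the tail of \<open>Q2 b\<close> is free of charge there: an avoiding template has no
  transitive triangle that ends at a vertex of a digon (\<open>supports_Q2_if_triangle_into_digon\<close>).
  This forces every label \<open>z\<close> to send and receive at most two arcs in total to and from the two
  ends of any digon (\<open>avoids_Q2_arcs_at_digon\<close>). Hence removing the same mass from both ends of
  a digon lowers the weight by no more than it lowers half the square of the total mass.
  Repeating this until no digon has positive mass on both ends leaves the case without digons
  (\<open>quadratic_form_le_square_sum\<close>).
\<close>

section \<open>A bound for quadratic forms\<close>

text \<open>In the application \<open>c i j\<close> counts the arcs between \<open>i\<close> and \<open>j\<close> in both directions,
  so that the left-hand side is twice the weight. The proof is by induction on the size of the
  support of \<open>f\<close>. For a pair \<open>x, y\<close> in the support with \<open>c x y > 1\<close>, subtracting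
  \<open>t = min (f x) (f y)\<close> at both points shrinks the support, and the hypothesis on the pair says
  that the linear and the quadratic term in \<open>t\<close> on the left are dominated by those
  of the square on the right.\<close>

lemma quadratic_form_le_square_sum:
  fixes c :: "'a \<Rightarrow> 'a \<Rightarrow> real" and f :: "'a \<Rightarrow> real"
  assumes fin: "finite V"
    and sym: "\<And>i j. c i j = c j i"
    and heavy: "\<And>x y z. x \<in> V \<Longrightarrow> y \<in> V \<Longrightarrow> z \<in> V \<Longrightarrow> c x y > 1 \<Longrightarrow> c z x + c z y \<le> 2"
    and nonneg: "\<And>v. v \<in> V \<Longrightarrow> f v \<ge> 0"
  shows "(\<Sum>i\<in>V. \<Sum>j\<in>V. c i j * f i * f j) \<le> (\<Sum>i\<in>V. f i)\<^sup>2"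
  using nonneg
proof (induction "card {v \<in> V. f v > 0}" arbitrary: f rule: less_induct)
  case less
  show ?case
  proof (cases "\<exists>x\<in>V. \<exists>y\<in>V. f x > 0 \<and> f y > 0 \<and> c x y > 1")
    case False
    have "c i j * f i * f j \<le> f i * f j" if "i \<in> V" "j \<in> V" for i j
    proof (cases "f i = 0 \<or> f j = 0")
      case True
      then show ?thesis by auto
    next
      case nz: False
      then have pos: "f i > 0" "f j > 0"
        using less.prems[of i] less.prems[of j] that by auto
      then have "c i j \<le> 1" using False that by force
      then have "c i j * (f i * f j) \<le> 1 * (f i * f j)"
        using pos by (intro mult_right_mono) auto
      then show ?thesis by (simp add: mult.assoc)
    qed
    then have "(\<Sum>i\<in>V. \<Sum>j\<in>V. c i j * f i * f j) \<le> (\<Sum>i\<in>V. \<Sum>j\<in>V. f i * f j)"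
      by (intro sum_mono) auto
    also have "\<dots> = (\<Sum>i\<in>V. f i)\<^sup>2"
      by (simp add: power2_eq_square sum_product)
    finally show ?thesis .
  next
    case True
    then obtain x y where xy: "x \<in> V" "y \<in> V" "f x > 0" "f y > 0" "c x y > 1" by blast
    have "x \<noteq> y" using heavy[of x y x] xy by auto
    define t where "t = min (f x) (f y)"
    \<comment> \<open>The perturbation direction \<open>\<delta>\<^sub>x + \<delta>\<^sub>y\<close>; below, \<open>f = g + t d\<close> is expanded in powers of \<open>t\<close>.\<close>
    define d :: "'a \<Rightarrow> real" where "d v = of_bool (v = x) + of_bool (v = y)" for v
    define g where "g v = f v - t * d v" for v
    have t: "t > 0" using xy by (simp add: t_def)
    have f_eq: "f v = g v + t * d v" for v by (simp add: g_def)
    have g_nonneg: "g v \<ge> 0" if "v \<in> V" for v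
      using less.prems[OF that] \<open>x \<noteq> y\<close> by (auto simp: g_def d_def t_def)
    have sum_d: "(\<Sum>j\<in>V. h j * d j) = h x + h y" for h :: "'a \<Rightarrow> real"
    proof -
      have "h j * d j = (if j = x then h j else 0) + (if j = y then h j else 0)" for j
        by (simp add: d_def)
      then show ?thesis using fin xy by (simp add: sum.distrib)
    qed
    have "g x = 0 \<or> g y = 0"
      using \<open>x \<noteq> y\<close> by (auto simp: g_def d_def t_def)
    moreover have "g v \<le> f v" for v using t by (simp add: g_def d_def)
    ultimately have "{v \<in> V. g v > 0} \<subset> {v \<in> V. f v > 0}"
      using xy by (force intro: less_le_trans)
    then have IH: "(\<Sum>i\<in>V. \<Sum>j\<in>V. c i j * g i * g j) \<le> (\<Sum>i\<in>V. g i)\<^sup>2"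
      using fin g_nonneg by (intro less.hyps psubset_card_mono) auto

    have linear: "(\<Sum>i\<in>V. g i * (c i x + c i y)) \<le> 2 * (\<Sum>i\<in>V. g i)"
    proof -
      have "(\<Sum>i\<in>V. g i * (c i x + c i y)) \<le> (\<Sum>i\<in>V. g i * 2)"
        using xy heavy g_nonneg by (intro sum_mono mult_left_mono) auto
      then show ?thesis by (simp add: mult.commute flip: sum_distrib_right)
    qed
    have quadratic: "(c x x + c x y) + (c y x + c y y) \<le> 4"
      using heavy[of x y x] heavy[of x y y] xy by simp

    have row: "(\<Sum>j\<in>V. c i j * f i * f j)
        = (\<Sum>j\<in>V. c i j * g i * g j) + t * (d i * (\<Sum>j\<in>V. c j i * g j))
          + t * (g i * (c i x + c i y)) + t\<^sup>2 * (d i * (c i x + c i y))" for i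
    proof -
      have "(\<Sum>j\<in>V. c i j * f i * f j)
          = (\<Sum>j\<in>V. c i j * g i * g j + t * d i * (c j i * g j) + (t * f i) * (c i j * d j))"
        by (intro sum.cong refl) (simp add: f_eq sym[of _ i] algebra_simps)
      also have "\<dots> = (\<Sum>j\<in>V. c i j * g i * g j) + t * d i * (\<Sum>j\<in>V. c j i * g j)
          + (t * f i) * (c i x + c i y)"
        by (simp add: sum.distrib sum_d flip: sum_distrib_left)
      finally show ?thesis by (simp add: f_eq algebra_simps power2_eq_square)
    qed
    have cross: "(\<Sum>i\<in>V. d i * (\<Sum>j\<in>V. c j i * g j)) = (\<Sum>i\<in>V. g i * (c i x + c i y))"
      using sum_d[of "\<lambda>i. \<Sum>j\<in>V. c j i * g j"]
      by (simp add: mult.commute distrib_left sum.distrib)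
    have square: "(\<Sum>i\<in>V. d i * (c i x + c i y)) = (c x x + c x y) + (c y x + c y y)"
      using sum_d[of "\<lambda>i. c i x + c i y"] by (simp add: mult.commute)
    have "(\<Sum>i\<in>V. \<Sum>j\<in>V. c i j * f i * f j)
        = (\<Sum>i\<in>V. \<Sum>j\<in>V. c i j * g i * g j) + 2 * t * (\<Sum>i\<in>V. g i * (c i x + c i y))
          + t\<^sup>2 * ((c x x + c x y) + (c y x + c y y))"
      unfolding row sum.distrib sum_distrib_left[symmetric] cross square by simp
    also have "\<dots> \<le> (\<Sum>i\<in>V. g i)\<^sup>2 + 2 * t * (2 * (\<Sum>i\<in>V. g i)) + t\<^sup>2 * 4"
      using t by (intro add_mono IH mult_left_mono linear quadratic) auto
    also have "\<dots> = ((\<Sum>i\<in>V. g i) + 2 * t)\<^sup>2"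
      by (simp add: power2_eq_square algebra_simps)
    also have "(\<Sum>i\<in>V. g i) + 2 * t = (\<Sum>i\<in>V. f i)"
      using sum_d[of "\<lambda>_. t"] by (simp add: f_eq sum.distrib)
    finally show ?thesis .
  qed
qed

section \<open>Digons in avoiding templates\<close>

text \<open>The tail \<open>3, 4, \<dots>, b + 3\<close> oscillates on the digon, starting from \<open>x\<close>
  at the odd vertex \<open>3\<close>.\<close>

lemma supports_Q2_if_triangle_into_digon:
  assumes T: "is_template T"
    and triangle: "(u, v) \<in> arcs T" "(u, x) \<in> arcs T" "(v, x) \<in> arcs T"
    and digon: "(x, y) \<in> arcs T" "(y, x) \<in> arcs T"
  shows "supports T (Q2 b)"
proof -
  define \<phi> :: "nat \<Rightarrow> 'a" where
    "\<phi> k = (if k = 1 then u else if k = 2 then v else if odd k then x else y)" for k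
  have "arcs T \<subseteq> labels T \<times> labels T" using T by (simp add: is_template_def)
  then have "\<phi> \<in> verts (Q2 b) \<rightarrow> labels T"
    using triangle digon by (auto simp: \<phi>_def)
  moreover have "(\<phi> i, \<phi> j) \<in> arcs T" if ij: "{i, j} \<in> edges (Q2 b)" "i < j" for i j
  proof -
    consider "i = 1" "j = 2" | "i = 1" "j = 3" | "i = 2" "j = 3" | "3 \<le> i" "j = i + 1"
      using ij by (auto simp: Q2_def doubleton_eq_iff)
    then show ?thesis
      using triangle digon by cases (auto simp: \<phi>_def)
  qed
  ultimately show ?thesis by (auto simp: supports_def)
qed

text \<open>If \<open>z \<rightarrow> x\<close>, then either of \<open>z \<rightarrow> y\<close> and \<open>y \<rightarrow> z\<close> would complete a transitive triangle
  ending at \<open>y\<close> or \<open>x\<close>, so \<open>z\<close> has arcs with \<open>x\<close> only. Symmetrically, if \<open>z \<rightarrow> y\<close>, then \<open>z\<close>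
  has arcs with \<open>y\<close> only. Otherwise \<open>z\<close> sends no arc to the digon. The case \<open>x = y = z\<close>
  rules out loops.\<close>

lemma avoids_Q2_arcs_at_digon:
  assumes T: "is_template T" and av: "avoids T (Q2 b)"
    and digon: "(x, y) \<in> arcs T" "(y, x) \<in> arcs T"
  shows "of_bool ((z, x) \<in> arcs T) + of_bool ((x, z) \<in> arcs T)
       + (of_bool ((z, y) \<in> arcs T) + of_bool ((y, z) \<in> arcs T)) \<le> (2 :: real)"
proof -
  note no = av supports_Q2_if_triangle_into_digon[OF T]
  have "(z, x) \<in> arcs T \<Longrightarrow> (z, y) \<notin> arcs T"
    using no digon by blast
  moreover have "(z, x) \<in> arcs T \<Longrightarrow> (y, z) \<notin> arcs T"
    using no digon by blast
  moreover have "(z, y) \<in> arcs T \<Longrightarrow> (x, z) \<notin> arcs T"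
    using no digon by blast
  ultimately show ?thesis by auto
qed

section \<open>The two bounds\<close>

lemma weight_le_half_if_avoids_Q2:
  assumes T: "is_template T" and av: "avoids T (Q2 b)"
  shows "weight T \<le> 1 / 2"
proof -
  let ?L = "labels T" and ?p = "pmf (mass T)"
  define a :: "'a \<Rightarrow> 'a \<Rightarrow> real" where "a i j = of_bool ((i, j) \<in> arcs T)" for i j
  define c where "c i j = a i j + a j i" for i j
  have fin: "finite ?L" and sub: "set_pmf (mass T) \<subseteq> ?L" and A: "arcs T \<subseteq> ?L \<times> ?L"
    using T by (auto simp: is_template_def)
  have "weight T = (\<Sum>(i, j)\<in>?L \<times> ?L. a i j * ?p i * ?p j)"
    unfolding weight_def using fin A
    by (intro sum.mono_neutral_cong_left) (auto simp: a_def)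
  then have w: "weight T = (\<Sum>i\<in>?L. \<Sum>j\<in>?L. a i j * ?p i * ?p j)"
    by (simp add: sum.cartesian_product)
  also have "\<dots> = (\<Sum>i\<in>?L. \<Sum>j\<in>?L. a j i * ?p i * ?p j)"
    by (subst sum.swap) (simp add: mult_ac)
  finally have "2 * weight T = (\<Sum>i\<in>?L. \<Sum>j\<in>?L. c i j * ?p i * ?p j)"
    using w by (simp add: c_def distrib_right sum.distrib)
  also have "\<dots> \<le> (\<Sum>i\<in>?L. ?p i)\<^sup>2"
  proof (rule quadratic_form_le_square_sum[OF fin])
    fix x y z assume "c x y > 1"
    then have "(x, y) \<in> arcs T" "(y, x) \<in> arcs T"
      by (auto simp: c_def a_def of_bool_def split: if_splits)
    from avoids_Q2_arcs_at_digon[OF T av this, of z]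
    show "c z x + c z y \<le> 2" by (simp add: c_def a_def)
  qed (auto simp: c_def)
  also have "\<dots> = 1" using sum_pmf_eq_1[OF fin sub] by simp
  finally show ?thesis by simp
qed

lemma ex_avoids_Q2_weight_half:
  "\<exists>T :: nat template. is_template T \<and> avoids T (Q2 b) \<and> weight T = 1 / 2"
proof -
  define T :: "nat template" where
    "T = \<lparr>labels = {0, 1}, mass = pmf_of_set {0, 1}, arcs = {(0, 1), (1, 0)}\<rparr>"
  have "is_template T" by (auto simp: T_def is_template_def)
  moreover have "avoids T (Q2 b)"
  proof
    assume "supports T (Q2 b)"
    then obtain \<phi> where "\<And>i j. {i, j} \<in> edges (Q2 b) \<Longrightarrow> i < j \<Longrightarrow> (\<phi> i, \<phi> j) \<in> arcs T"
      by (auto simp: supports_def)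
    from this[of 1 2] this[of 1 3] this[of 2 3] show False
      by (auto simp: T_def Q2_def)
  qed
  moreover have "weight T = 1 / 2"
    by (simp add: weight_def T_def)
  ultimately show ?thesis by blast
qed

theorem theorem4p1:
  fixes b :: nat
  assumes "b \<ge> 1"
  shows "lambda (Q2 b) = 1 / 2"
  unfolding lambda_def
proof (rule cSup_eq_maximum)
  show "1 / 2 \<in> {weight T | T :: nat template. is_template T \<and> avoids T (Q2 b)}"
    using ex_avoids_Q2_weight_half[of b] by force
qed (auto dest: weight_le_half_if_avoids_Q2)

end
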